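(* In the setting described in the context, assume that the rows $(E_{1,t})_t,\dots,(E_{n,t})_t$ of the error matrix in $Y=XB+E$ are independent AR(1) processes satisfying $$E_{i,t}-\phi_1E_{i,t-1}=Z_{i,t},\quad\forall i\in\{1,\dots,n\},$$ where the $Z_{i,t}$'s are zero-mean i.i.d. Gaussian random variables with variance $\sigma^2$ and $|\phi_1|<1$. Assume also that $X'X=\nu\,\mathrm{Id}_{\mathbb{R}^p}$, where $\nu$ is a positive constant. Moreover, suppose that if $j\in J$, then $j>p$ and $j<pq-p$. Suppose also that for all $j$, $j-p$ or $j+p$ is not in $J$. Then the strong Irrepresentable Condition holds: there exists a positive constant $\eta$, not depending on $n$, such that, element-wise, $$\left|(\mathcal{X}'\mathcal{X})_{J^c,J}\big((\mathcal{X}'\mathcal{X})_{J,J}\big)^{-1}\operatorname{sign}(\mathcal{B}_J)\right|\le(1-\eta)\mathbf{1},$$ where $\mathbf{1}$ is the vector of ones of length $pq-|J|$.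
   Context: Multivariate linear model: $Y=XB+E$ with $Y$ an $n\times q$ random response matrix, $X$ a deterministic $n\times p$ design matrix, $B$ a $p\times q$ coefficient matrix and $E=(E_{i,t})_{1\le i\le n,1\le t\le q}$ an $n\times q$ random error matrix. The number $p$ is fixed and $q=q_n$ may depend on $n$. The AR(1) processes are the stationary ones, $E_{i,t}=\sum_{j\ge0}\phi_1^jZ_{i,t-j}$; $\phi_1$ and $\sigma^2$ do not depend on $n$. $\Sigma$ is the $q\times q$ covariance matrix of each row $(E_{i,1},\dots,E_{i,q})$, and $\Sigma^{-1/2}$ is a matrix such that $\Sigma^{-1}=\Sigma^{-1/2}(\Sigma^{-1/2})'$ ($'$ denotes transpose). $\mathcal{X}=(\Sigma^{-1/2})'\otimes X$ (so $\mathcal{X}'\mathcal{X}=\Sigma^{-1}\otimes X'X$), $\mathcal{B}=\mathrm{vec}(B)\in\mathbb{R}^{pq}$, where $\mathrm{vec}$ stacks columns and $\otimes$ is the Kronecker product. $J=\{1\le j\le pq:\ \mathcal{B}_j\neq0\}$, and $J^c$ is its complement in $\{1,\dots,pq\}$. For a matrix $A$, $A_{I,K}$ is the submatrix with rows in $I$ and columns in $K$. $\operatorname{sign}$ and absolute values of vectors are taken entrywise. In the hypotheses on $J$, the index $j$ in "for all $j$" ranges over $\{1,\dots,pq\}$. *)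

theory Defs
  imports
    "HOL-Probability.Probability"
    "Jordan_Normal_Form.Matrix"
    "Jordan_Normal_Form.DL_Submatrix"
    "Jordan_Normal_Form.Gauss_Jordan_Elimination"
begin

no_notation Finite_Cartesian_Product.vec_nth (infixl "$" 90)
no_notation inner (infix "\<bullet>" 70)

text \<open>
  Matrices and vectors are those of the Jordan normal form library, whose entries are indexed
  from 0. Index sets of coefficients are subsets of \<open>{1..m}\<close>, as usual in the statistical
  literature; the shift happens in \<open>sub_mat\<close>, \<open>sub_vec\<close>, \<open>support\<close> and \<open>sample_mat\<close>.
\<close>

definition kronecker :: "real mat \<Rightarrow> real mat \<Rightarrow> real mat" where
  "kronecker A B =
    mat (dim_row A * dim_row B) (dim_col A * dim_col B)
      (\<lambda>(i, j). A $$ (i div dim_row B, j div dim_col B) * B $$ (i mod dim_row B, j mod dim_col B))"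

definition vec_stack :: "real mat \<Rightarrow> real Matrix.vec" where
  "vec_stack B =
    Matrix.vec (dim_row B * dim_col B) (\<lambda>k. B $$ (k mod dim_row B, k div dim_row B))"

definition support :: "real Matrix.vec \<Rightarrow> nat set" where
  "support b = {j \<in> {1..dim_vec b}. b $ (j - 1) \<noteq> 0}"

definition sub_mat :: "real mat \<Rightarrow> nat set \<Rightarrow> nat set \<Rightarrow> real mat" where
  "sub_mat A I K = submatrix A {i. Suc i \<in> I} {k. Suc k \<in> K}"

definition sub_vec :: "real Matrix.vec \<Rightarrow> nat set \<Rightarrow> real Matrix.vec" where
  "sub_vec b I =
    Matrix.vec (card {i. i < dim_vec b \<and> Suc i \<in> I}) (\<lambda>k. b $ pick {i. Suc i \<in> I} k)"

text \<open>
  \<open>mat_inverse\<close> returns an option, so \<open>mat_inv A\<close> is meaningful only for invertible \<open>A\<close>.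
\<close>

definition mat_inv :: "real mat \<Rightarrow> real mat" where
  "mat_inv A = the (mat_inverse A)"

text \<open>
  The order on vectors is entrywise and includes equality of the dimensions.
\<close>

definition irrepresentable :: "real mat \<Rightarrow> real Matrix.vec \<Rightarrow> real \<Rightarrow> bool" where
  "irrepresentable D b \<eta> \<longleftrightarrow>
    (let G = transpose_mat D * D;
         J = support b;
         Jc = {1..dim_vec b} - J
     in invertible_mat (sub_mat G J J) \<and>
        map_vec abs ((sub_mat G Jc J * mat_inv (sub_mat G J J)) *\<^sub>v map_vec sgn (sub_vec b J))
          \<le> (1 - \<eta>) \<cdot>\<^sub>v Matrix.vec (dim_vec b - card J) (\<lambda>_. 1))"

text \<open>
  The stationary solution of the AR(1) equation: the equation alone does not determine the
  process, the moving average representation does.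
\<close>

definition stationary_AR1 ::
    "'a measure \<Rightarrow> real \<Rightarrow> (int \<Rightarrow> 'a \<Rightarrow> real) \<Rightarrow> (int \<Rightarrow> 'a \<Rightarrow> real) \<Rightarrow> bool" where
  "stationary_AR1 M \<phi> Z E \<longleftrightarrow>
    (\<forall>t. E t \<in> borel_measurable M) \<and>
    (\<forall>t. AE \<omega> in M. E t \<omega> - \<phi> * E (t - 1) \<omega> = Z t \<omega>) \<and>
    (\<forall>t. AE \<omega> in M. (\<lambda>j. \<phi> ^ j * Z (t - int j) \<omega>) sums E t \<omega>)"

definition covariance :: "'a measure \<Rightarrow> ('a \<Rightarrow> real) \<Rightarrow> ('a \<Rightarrow> real) \<Rightarrow> real" where
  "covariance M U V =
    (\<integral>\<omega>. (U \<omega> - (\<integral>\<omega>'. U \<omega>' \<partial>M)) * (V \<omega> - (\<integral>\<omega>'. V \<omega>' \<partial>M)) \<partial>M)"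

definition covariance_mat :: "'a measure \<Rightarrow> nat \<Rightarrow> (int \<Rightarrow> 'a \<Rightarrow> real) \<Rightarrow> real mat" where
  "covariance_mat M q E = mat q q (\<lambda>(s, t). covariance M (E (int (Suc s))) (E (int (Suc t))))"

definition sample_mat :: "nat \<Rightarrow> nat \<Rightarrow> (nat \<Rightarrow> int \<Rightarrow> 'a \<Rightarrow> real) \<Rightarrow> 'a \<Rightarrow> real mat" where
  "sample_mat n q E \<omega> = mat n q (\<lambda>(i, t). E (Suc i) (int (Suc t)) \<omega>)"

end

theory Submission
  imports Defs "Jordan_Normal_Form.Determinant"
begin

text \<open>
  The stationary AR(1) covariance is proportional to \<open>(\<phi>\<^bsup>|s - t|\<^esup>)\<close>, so its inverse is tridiagonal, with
  off-diagonal entries \<open>- \<phi> / \<sigma>\<^sup>2\<close> and interior diagonal entries \<open>(1 + \<phi>\<^sup>2) / \<sigma>\<^sup>2\<close>. In the Gram matrix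
  \<open>\<Sigma>\<^sup>-\<^sup>1 \<otimes> X'X\<close> the row \<open>j\<close> therefore meets other columns only at \<open>j - p\<close> and \<open>j + p\<close>, of which at most one
  belongs to \<open>J\<close>. Up to the factor \<open>\<nu> / \<sigma>\<^sup>2\<close>, the block \<open>(J, J)\<close> is diagonally dominant with diagonal
  \<open>1 + \<phi>\<^sup>2\<close> and off-diagonal row sums at most \<open>|\<phi>|\<close>, so that its inverse has sup-norm at most
  \<open>1 / (1 + \<phi>\<^sup>2 - |\<phi>|)\<close>, and the rows outside \<open>J\<close> contribute one more factor \<open>|\<phi>|\<close>. Finally
  \<open>|\<phi>| / (1 + \<phi>\<^sup>2 - |\<phi>|) < 1\<close> because \<open>(1 - |\<phi>|)\<^sup>2 > 0\<close>.

  The autocovariances come from second moments only. Fatou's lemma bounds \<open>E\<^sub>t\<close> in \<open>L\<^sup>2\<close> uniformly in \<open>t\<close>;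
  a bounded sequence over \<open>\<int>\<close> that satisfies \<open>f t = c * f (t - 1)\<close> with \<open>|c| < 1\<close> vanishes, and the AR(1)
  equation yields such a recursion for the mean, for the covariance of \<open>E\<^sub>s\<close> with a later noise, and for
  the deviation of the variance from \<open>\<sigma>\<^sup>2 / (1 - \<phi>\<^sup>2)\<close>.
\<close>

section \<open>Diagonally dominant Gram matrices\<close>

text \<open>In a row \<open>i\<close> where |x| is largest, the diagonal term has size at least
  \<open>d * |x_i|\<close> and the other terms together at most \<open>e * |x_i|\<close>. The case
  \<open>c = 0\<close> gives a trivial kernel, and \<open>c = 1\<close> a sup-norm bound for the
  inverse.\<close>

lemma dominant_mult_vec_bound:
  fixes A :: "real mat"
  assumes A: "A \<in> carrier_mat r r" and x: "x \<in> carrier_vec r"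
    and diag: "\<And>i. i < r \<Longrightarrow> d \<le> \<bar>A $$ (i, i)\<bar>"
    and off: "\<And>i. i < r \<Longrightarrow> (\<Sum>k\<in>{0..<r} - {i}. \<bar>A $$ (i, k)\<bar>) \<le> e"
    and de: "e < d"
    and y: "\<And>i. i < r \<Longrightarrow> \<bar>(A *\<^sub>v x) $ i\<bar> \<le> c"
    and j: "j < r"
  shows "(d - e) * \<bar>x $ j\<bar> \<le> c"
proof -
  obtain i where i: "i < r" and max: "\<And>k. k < r \<Longrightarrow> \<bar>x $ k\<bar> \<le> \<bar>x $ i\<bar>"
  proof -
    have "Max ((\<lambda>k. \<bar>x $ k\<bar>) ` {0..<r}) \<in> (\<lambda>k. \<bar>x $ k\<bar>) ` {0..<r}"
      using j by (intro Max_in) auto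
    then obtain i where "i < r" "\<bar>x $ i\<bar> = Max ((\<lambda>k. \<bar>x $ k\<bar>) ` {0..<r})" by auto
    then show ?thesis using that[of i] by auto
  qed
  have "(A *\<^sub>v x) $ i = (\<Sum>k\<in>{0..<r}. A $$ (i, k) * x $ k)"
    using A x i by (auto simp: scalar_prod_def)
  also have "\<dots> = A $$ (i, i) * x $ i + (\<Sum>k\<in>{0..<r} - {i}. A $$ (i, k) * x $ k)"
    using i by (subst sum.remove[of _ i]) auto
  finally have "\<bar>A $$ (i, i) * x $ i\<bar> \<le>
      \<bar>(A *\<^sub>v x) $ i\<bar> + \<bar>\<Sum>k\<in>{0..<r} - {i}. A $$ (i, k) * x $ k\<bar>"
    by linarith
  also have "\<bar>\<Sum>k\<in>{0..<r} - {i}. A $$ (i, k) * x $ k\<bar> \<le> (\<Sum>k\<in>{0..<r} - {i}. \<bar>A $$ (i, k)\<bar> * \<bar>x $ i\<bar>)"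
    by (rule order_trans[OF sum_abs]) (auto simp: abs_mult intro!: sum_mono mult_left_mono max)
  also have "\<dots> \<le> e * \<bar>x $ i\<bar>"
    unfolding sum_distrib_right[symmetric] by (intro mult_right_mono off i) auto
  finally have "\<bar>A $$ (i, i)\<bar> * \<bar>x $ i\<bar> \<le> c + e * \<bar>x $ i\<bar>" using y[OF i] by (simp add: abs_mult)
  moreover have "d * \<bar>x $ i\<bar> \<le> \<bar>A $$ (i, i)\<bar> * \<bar>x $ i\<bar>" by (intro mult_right_mono diag i) auto
  ultimately have "(d - e) * \<bar>x $ i\<bar> \<le> c" by (simp add: algebra_simps)
  moreover have "(d - e) * \<bar>x $ j\<bar> \<le> (d - e) * \<bar>x $ i\<bar>"
    using de max[OF j] by (intro mult_left_mono) auto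
  ultimately show ?thesis by simp
qed

text \<open>Links the option-valued \<open>mat_inverse\<close> to an explicit inverse: over a field
  a left inverse of a square matrix is also a right inverse, so \<open>A\<close> is a unit and
  \<open>mat_inverse\<close> cannot return \<open>None\<close>.\<close>

lemma mat_inv_unique:
  assumes A: "A \<in> carrier_mat r r" and B: "B \<in> carrier_mat r r" and AB: "B * A = 1\<^sub>m r"
  shows "mat_inv A = B" and "A * B = 1\<^sub>m r" and "invertible_mat A"
proof -
  show BA: "A * B = 1\<^sub>m r" by (rule mat_mult_left_right_inverse[OF B A AB])
  have "A \<in> Units (ring_mat TYPE(real) r ())"
    using A B AB BA by (auto simp: Units_def ring_mat_def)
  then obtain C where C: "mat_inverse A = Some C"
    using mat_inverse(1)[OF A, of "()"] by (cases "mat_inverse A") auto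
  from mat_inverse(2)[OF A C] have C': "A * C = 1\<^sub>m r" "C \<in> carrier_mat r r" by auto
  have "B = B * (A * C)" using B C' by simp
  also have "\<dots> = C" using A B C' AB by (subst assoc_mult_mat[symmetric]) auto
  finally show "mat_inv A = B" using C by (simp add: mat_inv_def)
  show "invertible_mat A"
    using A B AB BA unfolding invertible_mat_def inverts_mat_def square_mat.simps by auto
qed

lemma dominant_invertible:
  fixes A :: "real mat"
  assumes A: "A \<in> carrier_mat r r"
    and diag: "\<And>i. i < r \<Longrightarrow> d \<le> \<bar>A $$ (i, i)\<bar>"
    and off: "\<And>i. i < r \<Longrightarrow> (\<Sum>k\<in>{0..<r} - {i}. \<bar>A $$ (i, k)\<bar>) \<le> e"
    and de: "e < d"
  shows "invertible_mat A" "mat_inv A \<in> carrier_mat r r" "A * mat_inv A = 1\<^sub>m r"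
proof -
  have "v = 0\<^sub>v r" if v: "v \<in> carrier_vec r" "A *\<^sub>v v = 0\<^sub>v r" for v
  proof (rule eq_vecI)
    fix j assume "j < dim_vec (0\<^sub>v r :: real Matrix.vec)"
    then have j: "j < r" by simp
    have "(d - e) * \<bar>v $ j\<bar> \<le> 0"
      by (rule dominant_mult_vec_bound[OF A v(1) diag off de _ j]) (auto simp: v)
    then show "v $ j = 0\<^sub>v r $ j" using de j by (simp add: mult_le_0_iff)
  qed (use v in auto)
  then have "det A \<noteq> 0" using det_0_iff_vec_prod_zero_field[OF A] by blast
  then have "A \<in> Units (ring_mat TYPE(real) r ())" by (rule det_non_zero_imp_unit[OF A])
  then obtain B where B: "B \<in> carrier_mat r r" "B * A = 1\<^sub>m r"
    by (auto simp: Units_def ring_mat_def)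
  show "invertible_mat A" "mat_inv A \<in> carrier_mat r r" "A * mat_inv A = 1\<^sub>m r"
    using mat_inv_unique[OF A B] B by auto
qed

text \<open>Submatrices number their rows and columns through \<open>pick\<close>; this bijection
  turns sums over a submatrix into sums over the index set itself.\<close>

lemma bij_betw_pick: "bij_betw (pick I) {0..<card {a. a < m \<and> a \<in> I}} {a. a < m \<and> a \<in> I}"
  (is "bij_betw _ {0..<card ?S} _")
proof -
  have fin: "finite ?S" by simp
  have eq: "pick I i = pick ?S i" if "i < card ?S" for i
    using that by (rule pick_reduce_set)
  have inj: "inj_on (pick ?S) {0..<card ?S}"
    by (rule strict_mono_on_imp_inj_on, rule strict_mono_onI) (simp add: pick_mono_le)
  have sub: "pick ?S ` {0..<card ?S} \<subseteq> ?S"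
    by (rule image_subsetI, rule pick_in_set_le) simp
  have "bij_betw (pick ?S) {0..<card ?S} ?S"
    using inj sub card_subset_eq[OF fin sub] by (auto simp: bij_betw_def card_image)
  then show ?thesis using bij_betw_cong[of "{0..<card ?S}" "pick I" "pick ?S"] eq by auto
qed

text \<open>With \<open>x\<close> the inverse of the block (J, J) applied to the signs, dominance
  gives |x| \<le> 1 / (d - e), and a row outside \<open>J\<close> adds a factor of at most
  \<open>e\<close>. Hence \<open>off\<close> ranges over all rows: those in \<open>J\<close> for the
  inverse, the others for the last factor.\<close>

lemma irrepresentable_dominant:
  fixes D :: "real mat" and b :: "real Matrix.vec"
  defines "G \<equiv> transpose_mat D * D" and "J \<equiv> {a. a < dim_vec b \<and> b $ a \<noteq> 0}"
  assumes D: "dim_col D = dim_vec b"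
    and diag: "\<And>a. a \<in> J \<Longrightarrow> d \<le> \<bar>G $$ (a, a)\<bar>"
    and off: "\<And>a. a < dim_vec b \<Longrightarrow> (\<Sum>k\<in>J - {a}. \<bar>G $$ (a, k)\<bar>) \<le> e"
    and de: "e < d" and eta: "e / (d - e) \<le> 1 - \<eta>" "\<eta> \<le> 1"
  shows "irrepresentable D b \<eta>"
proof -
  define m where "m = dim_vec b"
  \<comment> \<open>\<open>K\<close> and \<open>Kc\<close> count from 1, as in
    \<open>irrepresentable\<close>; \<open>J\<close>, \<open>P\<close> and \<open>Pc\<close> count
    from 0, as the matrix entries do.\<close>
  define K where "K = support b"
  define Kc where "Kc = {1..m} - K"
  define P where "P = {k. Suc k \<in> K}"
  define Pc where "Pc = {k. Suc k \<in> Kc}"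
  have G: "G \<in> carrier_mat m m" using D by (auto simp: G_def m_def)
  have JP: "{a. a < m \<and> a \<in> P} = J" by (auto simp: J_def P_def K_def support_def m_def)
  have JPc: "{a. a < m \<and> a \<in> Pc} = {0..<m} - J"
    by (auto simp: J_def Pc_def Kc_def K_def support_def m_def)
  define r where "r = card J"
  define A where "A = sub_mat G K K"
  define C where "C = sub_mat G Kc K"
  have fin: "finite J" by (simp add: J_def)
  have bij: "bij_betw (pick P) {0..<r} J"
    using bij_betw_pick[of P m] unfolding JP r_def .
  have bijc: "bij_betw (pick Pc) {0..<card ({0..<m} - J)} ({0..<m} - J)"
    using bij_betw_pick[of Pc m] unfolding JPc .
  have K: "card K = r"
  proof -
    have "j \<in> Suc ` J" if "j \<in> K" for j
      using that by (cases j) (auto simp: J_def K_def support_def)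
    moreover have "Suc ` J \<subseteq> K" by (auto simp: J_def K_def support_def)
    ultimately have "K = Suc ` J" by blast
    then show ?thesis by (simp add: r_def card_image)
  qed
  have cc: "card ({0..<m} - J) = m - r"
    using fin by (subst card_Diff_subset) (auto simp: J_def r_def m_def)
  have A: "A \<in> carrier_mat r r"
    unfolding A_def sub_mat_def using G JP
    by (intro carrier_matI) (simp_all add: dim_submatrix P_def r_def)
  have C: "C \<in> carrier_mat (m - r) r"
    unfolding C_def sub_mat_def using G JP JPc
    by (intro carrier_matI) (simp_all add: dim_submatrix P_def Pc_def r_def cc[unfolded r_def])
  have Aij: "A $$ (i, k) = G $$ (pick P i, pick P k)" if "i < r" "k < r" for i k
    unfolding A_def sub_mat_def P_def
    by (rule submatrix_index) (use that G JP in \<open>simp_all add: P_def r_def\<close>)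
  have Cij: "C $$ (i, k) = G $$ (pick Pc i, pick P k)" if "i < m - r" "k < r" for i k
    unfolding C_def sub_mat_def P_def Pc_def
    by (rule submatrix_index) (use that G JP JPc cc in \<open>simp_all add: P_def Pc_def r_def\<close>)
  have pick_J: "pick P i \<in> J" if "i < r" for i
    using bij that by (auto simp: bij_betw_def)
  have pick_Jc: "pick Pc i < m" "pick Pc i \<notin> J" if "i < m - r" for i
    using bijc that unfolding cc by (auto simp: bij_betw_def)
  have dA: "d \<le> \<bar>A $$ (i, i)\<bar>" if "i < r" for i
    using diag[OF pick_J[OF that]] by (simp add: Aij that)
  have oA: "(\<Sum>k\<in>{0..<r} - {i}. \<bar>A $$ (i, k)\<bar>) \<le> e" if i: "i < r" for i
  proof -
    have "bij_betw (pick P) ({0..<r} - {i}) (J - {pick P i})"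
      using bij_betw_DiffI[OF bij, of "{i}" "{pick P i}"] i pick_J by (auto simp: bij_betw_def)
    then have "(\<Sum>k\<in>{0..<r} - {i}. \<bar>G $$ (pick P i, pick P k)\<bar>) = (\<Sum>k\<in>J - {pick P i}. \<bar>G $$ (pick P i, k)\<bar>)"
      by (rule sum.reindex_bij_betw)
    also have "\<dots> \<le> e" using pick_J[OF i] by (intro off) (auto simp: J_def)
    finally show ?thesis using i by (simp add: Aij)
  qed
  note inv = dominant_invertible[OF A dA oA de]
  define s where "s = map_vec sgn (sub_vec b K)"
  have s: "s \<in> carrier_vec r"
    unfolding s_def sub_vec_def using JP by (simp add: P_def r_def m_def)
  have s1: "\<bar>s $ i\<bar> \<le> 1" if "i < r" for i
    using that s unfolding s_def sub_vec_def by (auto simp: abs_sgn_eq)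
  define x where "x = mat_inv A *\<^sub>v s"
  have x: "x \<in> carrier_vec r" using inv s by (auto simp: x_def)
  have Ax: "A *\<^sub>v x = s"
    using A inv s unfolding x_def by (subst assoc_mult_mat_vec[symmetric]) auto
  have xb: "\<bar>x $ j\<bar> \<le> 1 / (d - e)" if "j < r" for j
    using dominant_mult_vec_bound[OF A x dA oA de _ that, of 1] s1 de
    unfolding Ax by (simp add: field_simps)
  have Cx: "\<bar>(C *\<^sub>v x) $ i\<bar> \<le> 1 - \<eta>" if i: "i < m - r" for i
  proof -
    have "(C *\<^sub>v x) $ i = (\<Sum>k\<in>{0..<r}. C $$ (i, k) * x $ k)"
      using C x i by (auto simp: scalar_prod_def)
    then have "\<bar>(C *\<^sub>v x) $ i\<bar> \<le> (\<Sum>k\<in>{0..<r}. \<bar>C $$ (i, k) * x $ k\<bar>)" by simp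
    also have "\<dots> \<le> (\<Sum>k\<in>{0..<r}. \<bar>G $$ (pick Pc i, pick P k)\<bar> * (1 / (d - e)))"
      unfolding abs_mult using i by (intro sum_mono mult_mono xb) (simp_all add: Cij)
    also have "\<dots> = (\<Sum>k\<in>J. \<bar>G $$ (pick Pc i, k)\<bar> * (1 / (d - e)))"
      using bij by (rule sum.reindex_bij_betw)
    \<comment> \<open>The row index is outside \<open>J\<close>, so removing it changes nothing but
      brings the sum into the form of \<open>off\<close>.\<close>
    also have "\<dots> = (\<Sum>k\<in>J - {pick Pc i}. \<bar>G $$ (pick Pc i, k)\<bar>) * (1 / (d - e))"
      unfolding sum_distrib_right using pick_Jc(2)[OF i] by (intro sum.cong) auto
    also have "\<dots> \<le> e * (1 / (d - e))"
      using pick_Jc[OF i] de by (intro mult_right_mono off) (auto simp: m_def)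
    finally show ?thesis using eta by simp
  qed
  have "C * mat_inv A *\<^sub>v s = C *\<^sub>v x"
    unfolding x_def by (rule assoc_mult_mat_vec[OF C inv(2) s])
  then have "map_vec abs ((C * mat_inv A) *\<^sub>v s) \<le> (1 - \<eta>) \<cdot>\<^sub>v Matrix.vec (m - r) (\<lambda>_. 1)"
    using C Cx by (auto simp: less_eq_vec_def)
  then show ?thesis
    using inv(1) unfolding irrepresentable_def Let_def G_def[symmetric] K_def[symmetric] m_def[symmetric]
      Kc_def[symmetric] A_def[symmetric] C_def[symmetric] s_def[symmetric] K by simp
qed

text \<open>Entrywise form of the mixed-product rule. The rows of the Kronecker product fall into
  \<open>q'\<close> blocks of length \<open>n\<close>, over which the double sum factorises.\<close>

lemma gram_kronecker:
  assumes T: "T \<in> carrier_mat q' q" and X: "X \<in> carrier_mat n p"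
    and a: "a < q * p" and b: "b < q * p"
  shows "(transpose_mat (kronecker T X) * kronecker T X) $$ (a, b) =
    (transpose_mat T * T) $$ (a div p, b div p) * (transpose_mat X * X) $$ (a mod p, b mod p)"
proof -
  have p: "p > 0" using a by (cases p) auto
  have ab: "a div p < q" "b div p < q" "a mod p < p" "b mod p < p"
    using a b p by (auto simp: less_mult_imp_div_less)
  let ?f = "\<lambda>i k. T $$ (i, a div p) * T $$ (i, b div p) * (X $$ (k, a mod p) * X $$ (k, b mod p))"
  have "(transpose_mat (kronecker T X) * kronecker T X) $$ (a, b) =
      (\<Sum>k<q' * n. ?f (k div n) (k mod n))"
    using T X a b by (auto simp: kronecker_def scalar_prod_def lessThan_atLeast0 intro!: sum.cong)
  also have "\<dots> = (\<Sum>i<q'. \<Sum>k\<in>{i * n..<i * n + n}. ?f (k div n) (k mod n))"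
    by (rule sum.nat_group[symmetric])
  also have "\<dots> = (\<Sum>i<q'. \<Sum>k<n. ?f i k)"
  proof (rule sum.cong[OF refl])
    fix i
    have "(\<Sum>k\<in>{i * n..<i * n + n}. ?f (k div n) (k mod n)) =
        (\<Sum>k\<in>{0..<n}. ?f ((k + i * n) div n) ((k + i * n) mod n))"
      using sum.shift_bounds_nat_ivl[of "\<lambda>k. ?f (k div n) (k mod n)" 0 "i * n" n] by (simp add: add.commute)
    also have "\<dots> = (\<Sum>k<n. ?f i k)" by (auto simp: lessThan_atLeast0 intro!: sum.cong)
    finally show "(\<Sum>k\<in>{i * n..<i * n + n}. ?f (k div n) (k mod n)) = (\<Sum>k<n. ?f i k)" .
  qed
  also have "\<dots> = (\<Sum>i<q'. T $$ (i, a div p) * T $$ (i, b div p)) * (\<Sum>k<n. X $$ (k, a mod p) * X $$ (k, b mod p))"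
    by (simp add: sum_product)
  also have "\<dots> = (transpose_mat T * T) $$ (a div p, b div p) * (transpose_mat X * X) $$ (a mod p, b mod p)"
    using T X ab by (auto simp: scalar_prod_def lessThan_atLeast0)
  finally show ?thesis .
qed

section \<open>Autocovariance and precision matrices of AR(1) processes\<close>

text \<open>The AR(1) correlation matrix; the case distinction expresses |s - t| despite truncated
  subtraction.\<close>

definition ar1_cov :: "real \<Rightarrow> nat \<Rightarrow> real mat" where
  "ar1_cov \<phi> q = mat q q (\<lambda>(s, t). \<phi> ^ (if s \<le> t then t - s else s - t))"

text \<open>For \<open>2 \<le> q\<close> this is \<open>1 - \<phi>\<^sup>2\<close> times the inverse
  of \<open>ar1_cov\<close>. The two corners have one neighbour only and so lack the summand
  \<open>\<phi>\<^sup>2\<close>.\<close>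

definition ar1_prec :: "real \<Rightarrow> nat \<Rightarrow> real mat" where
  "ar1_prec \<phi> q = mat q q (\<lambda>(s, t). if s = t then (if s = 0 \<or> Suc s = q then 1 else 1 + \<phi>\<^sup>2)
     else if Suc s = t \<or> Suc t = s then - \<phi> else 0)"

text \<open>Off the diagonal the two or three terms of a row cancel, since consecutive entries of a
  column of \<open>ar1_cov\<close> differ by a factor \<phi>; only at the diagonal does the
  direction of decay change.\<close>

lemma ar1_prec_mult_cov:
  assumes "2 \<le> q"
  shows "ar1_prec \<phi> q * ar1_cov \<phi> q = (1 - \<phi>\<^sup>2) \<cdot>\<^sub>m 1\<^sub>m q"
proof (rule eq_matI)
  fix s u assume "s < dim_row ((1 - \<phi>\<^sup>2) \<cdot>\<^sub>m 1\<^sub>m q)" "u < dim_col ((1 - \<phi>\<^sup>2) \<cdot>\<^sub>m 1\<^sub>m q)"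
  then have s: "s < q" and u: "u < q" by auto
  let ?R = "\<lambda>t. \<phi> ^ (if t \<le> u then u - t else t - u)"
  let ?P = "\<lambda>t. if s = t then (if s = 0 \<or> Suc s = q then 1 else 1 + \<phi>\<^sup>2)
     else if Suc s = t \<or> Suc t = s then - \<phi> else 0"
  let ?N = "{t. t < q \<and> (t = s \<or> t = Suc s \<or> Suc t = s)}"
  have "(ar1_prec \<phi> q * ar1_cov \<phi> q) $$ (s, u) = (\<Sum>t<q. ?P t * ?R t)"
    using s u by (auto simp: ar1_prec_def ar1_cov_def scalar_prod_def lessThan_atLeast0 intro!: sum.cong)
  also have "\<dots> = (\<Sum>t\<in>?N. ?P t * ?R t)"
    by (rule sum.mono_neutral_right) auto
  also have "\<dots> = (if s = u then 1 - \<phi>\<^sup>2 else 0)"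
  proof -
    consider (first) "s = 0" | (last) "s \<noteq> 0" "Suc s = q" | (mid) "s \<noteq> 0" "Suc s < q"
      using s by linarith
    then show ?thesis
    proof cases
      case first
      then have "?N = {0, 1}" using assms by auto
      then show ?thesis using first u
        by (cases u) (auto simp: power2_eq_square)
    next
      case last
      then obtain r where r: "s = Suc r" by (cases s) auto
      have "?N = {r, Suc r}" using last r by auto
      moreover have "u \<le> r \<or> u = Suc r" using u last r by auto
      ultimately show ?thesis using last r
        by (elim disjE) (simp_all add: power2_eq_square Suc_diff_le)
    next
      case mid
      then obtain r where r: "s = Suc r" by (cases s) auto
      have "?N = {r, Suc r, Suc (Suc r)}" using mid r by auto
      then have eq: "(\<Sum>t\<in>?N. ?P t * ?R t) =
          - \<phi> * ?R r + ((1 + \<phi>\<^sup>2) * ?R (Suc r) + - \<phi> * ?R (Suc (Suc r)))"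
        using mid r by (simp only:) simp
      \<comment> \<open>The column lies left of, at or right of the diagonal position
        \<open>s = Suc r\<close>; this form lets the truncated differences simplify.\<close>
      consider "u \<le> r" | "u = Suc r" | k where "u = Suc (Suc r) + k"
        by (metis le_iff_add not_less_eq_eq le_antisym)
      then show ?thesis
      proof cases
        case 1
        then show ?thesis using r unfolding eq
          by (simp add: power2_eq_square Suc_diff_le algebra_simps)
      next
        case 2
        then show ?thesis using r unfolding eq
          by (simp add: power2_eq_square algebra_simps)
      next
        case 3
        then show ?thesis using r unfolding eq
          by (simp add: power2_eq_square algebra_simps)
      qed
    qed
  qed
  finally show "(ar1_prec \<phi> q * ar1_cov \<phi> q) $$ (s, u) = ((1 - \<phi>\<^sup>2) \<cdot>\<^sub>m 1\<^sub>m q) $$ (s, u)"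
    using s u by simp
qed (auto simp: ar1_prec_def ar1_cov_def)

section \<open>Second moments of AR(1) processes\<close>

lemma abs_mult_le_squares: "\<bar>x * y\<bar> \<le> x\<^sup>2 + y\<^sup>2" for x y :: real
proof -
  have "2 * (\<bar>x\<bar> * \<bar>y\<bar>) \<le> x\<^sup>2 + y\<^sup>2"
    using sum_squares_bound[of "\<bar>x\<bar>" "\<bar>y\<bar>"] by (simp add: mult.assoc)
  moreover have "0 \<le> \<bar>x\<bar> * \<bar>y\<bar>" by simp
  ultimately show ?thesis unfolding abs_mult by linarith
qed

lemma integrable_mult_L2:
  fixes U V :: "'a \<Rightarrow> real"
  assumes [measurable]: "U \<in> borel_measurable M" "V \<in> borel_measurable M"
    and "integrable M (\<lambda>\<omega>. (U \<omega>)\<^sup>2)" "integrable M (\<lambda>\<omega>. (V \<omega>)\<^sup>2)"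
  shows "integrable M (\<lambda>\<omega>. U \<omega> * V \<omega>)"
proof (rule Bochner_Integration.integrable_bound)
  show "integrable M (\<lambda>\<omega>. (U \<omega>)\<^sup>2 + (V \<omega>)\<^sup>2)" using assms by simp
  show "AE \<omega> in M. norm (U \<omega> * V \<omega>) \<le> norm ((U \<omega>)\<^sup>2 + (V \<omega>)\<^sup>2)"
  proof (rule AE_I2)
    fix \<omega>
    show "norm (U \<omega> * V \<omega>) \<le> norm ((U \<omega>)\<^sup>2 + (V \<omega>)\<^sup>2)"
      using abs_mult_le_squares[of "U \<omega>" "V \<omega>"] by simp
  qed
qed measurable

text \<open>A crude form of Cauchy-Schwarz without square roots. It supplies the bounds, uniform in
  time, that \<open>zero_by_contraction\<close> asks for.\<close>

lemma abs_integral_mult_le: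
  fixes U V :: "'a \<Rightarrow> real"
  assumes [measurable]: "U \<in> borel_measurable M" "V \<in> borel_measurable M"
    and U: "integrable M (\<lambda>\<omega>. (U \<omega>)\<^sup>2)" and V: "integrable M (\<lambda>\<omega>. (V \<omega>)\<^sup>2)"
  shows "\<bar>\<integral>\<omega>. U \<omega> * V \<omega> \<partial>M\<bar> \<le> (\<integral>\<omega>. (U \<omega>)\<^sup>2 \<partial>M) + (\<integral>\<omega>. (V \<omega>)\<^sup>2 \<partial>M)"
proof -
  have "\<bar>\<integral>\<omega>. U \<omega> * V \<omega> \<partial>M\<bar> \<le> (\<integral>\<omega>. \<bar>U \<omega> * V \<omega>\<bar> \<partial>M)" by (rule integral_abs_bound)
  also have "\<dots> \<le> (\<integral>\<omega>. (U \<omega>)\<^sup>2 + (V \<omega>)\<^sup>2 \<partial>M)"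
  proof (rule integral_mono)
    show "integrable M (\<lambda>\<omega>. \<bar>U \<omega> * V \<omega>\<bar>)"
      using integrable_mult_L2[OF assms] by (rule integrable_abs)
    fix \<omega>
    show "\<bar>U \<omega> * V \<omega>\<bar> \<le> (U \<omega>)\<^sup>2 + (V \<omega>)\<^sup>2"
      by (rule abs_mult_le_squares)
  qed (use U V in simp)
  also have "\<dots> = (\<integral>\<omega>. (U \<omega>)\<^sup>2 \<partial>M) + (\<integral>\<omega>. (V \<omega>)\<^sup>2 \<partial>M)"
    using U V by simp
  finally show ?thesis .
qed

text \<open>The moving average representation gives almost sure convergence; Fatou's lemma turns it
  into an L^2 bound for the limit.\<close>

lemma Fatou_square_integrable:
  fixes U :: "nat \<Rightarrow> 'a \<Rightarrow> real"
  assumes U: "\<And>k. integrable M (\<lambda>\<omega>. (U k \<omega>)\<^sup>2)"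
    and bound: "\<And>k. (\<integral>\<omega>. (U k \<omega>)\<^sup>2 \<partial>M) \<le> C"
    and V[measurable]: "V \<in> borel_measurable M"
    and lim: "AE \<omega> in M. (\<lambda>k. U k \<omega>) \<longlonglongrightarrow> V \<omega>"
  shows "integrable M (\<lambda>\<omega>. (V \<omega>)\<^sup>2)" and "(\<integral>\<omega>. (V \<omega>)\<^sup>2 \<partial>M) \<le> C"
proof -
  have C: "0 \<le> C" by (rule order_trans[OF _ bound[of 0]]) simp
  have [measurable]: "(\<lambda>\<omega>. (U k \<omega>)\<^sup>2) \<in> borel_measurable M" for k using U by simp
  have "(\<integral>\<^sup>+\<omega>. ennreal ((V \<omega>)\<^sup>2) \<partial>M) = (\<integral>\<^sup>+\<omega>. liminf (\<lambda>k. ennreal ((U k \<omega>)\<^sup>2)) \<partial>M)"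
    using lim
  proof (intro nn_integral_cong_AE, eventually_elim)
    case (elim \<omega>)
    then have "(\<lambda>k. ennreal ((U k \<omega>)\<^sup>2)) \<longlonglongrightarrow> ennreal ((V \<omega>)\<^sup>2)"
      by (intro tendsto_ennrealI tendsto_intros)
    then show ?case by (rule lim_imp_Liminf[OF sequentially_bot, symmetric])
  qed
  also have "\<dots> \<le> liminf (\<lambda>k. \<integral>\<^sup>+\<omega>. ennreal ((U k \<omega>)\<^sup>2) \<partial>M)"
    by (rule nn_integral_liminf) measurable
  also have "\<dots> \<le> liminf (\<lambda>k. ennreal C)"
    using bound by (intro Liminf_mono always_eventually) (simp add: nn_integral_eq_integral[OF U] ennreal_leI)
  finally have le: "(\<integral>\<^sup>+\<omega>. ennreal ((V \<omega>)\<^sup>2) \<partial>M) \<le> ennreal C" by (simp add: Liminf_const)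
  then show "integrable M (\<lambda>\<omega>. (V \<omega>)\<^sup>2)"
    by (intro integrableI_nonneg) (auto simp: order_le_less_trans[OF le])
  then show "(\<integral>\<omega>. (V \<omega>)\<^sup>2 \<partial>M) \<le> C"
    using le C by (simp add: nn_integral_eq_integral)
qed

text \<open>Going back \<open>k\<close> steps gives \<open>f s = c ^ k * f (s - k)\<close>, which
  tends to 0. The recursion is asked for only up to \<open>s\<close>, because for
  \<open>EZ_future\<close> it holds only before the time of the noise.\<close>

lemma zero_by_contraction:
  fixes f :: "int \<Rightarrow> real"
  assumes "\<bar>c\<bar> < 1" and bound: "\<And>t. \<bar>f t\<bar> \<le> C" and rec: "\<And>t. t \<le> s \<Longrightarrow> f t = c * f (t - 1)"
  shows "f s = 0"
proof -
  have eq: "f s = c ^ k * f (s - int k)" for k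
    by (induction k) (auto simp: rec[of "s - int _"] algebra_simps)
  have "\<bar>f s\<bar> \<le> \<bar>c\<bar> ^ k * C" for k
    by (subst eq[of k]) (auto simp: abs_mult power_abs intro!: mult_left_mono bound)
  moreover have "(\<lambda>k. \<bar>c\<bar> ^ k * C) \<longlonglongrightarrow> 0 * C"
    using assms(1) by (intro tendsto_mult LIMSEQ_power_zero tendsto_const) auto
  ultimately have "\<bar>f s\<bar> \<le> 0 * C" by (intro LIMSEQ_le_const) auto
  then show ?thesis by simp
qed

text \<open>Second-order assumptions alone: a centred, uncorrelated noise of variance
  \<open>v\<close> determines the autocovariance.\<close>

locale white_noise_AR1 = prob_space M for M :: "'a measure" +
  fixes \<phi> v :: real and Z E :: "int \<Rightarrow> 'a \<Rightarrow> real"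
  assumes phi: "\<bar>\<phi>\<bar> < 1"
    and Z_measurable [measurable]: "\<And>t. Z t \<in> borel_measurable M"
    and Z_square: "\<And>t. integrable M (\<lambda>\<omega>. (Z t \<omega>)\<^sup>2)"
    and Z_mean: "\<And>t. expectation (Z t) = 0"
    and Z_cov: "\<And>s t. expectation (\<lambda>\<omega>. Z s \<omega> * Z t \<omega>) = (if s = t then v else 0)"
    and AR1: "stationary_AR1 M \<phi> Z E"
begin

lemma E_measurable [measurable]: "E t \<in> borel_measurable M"
  and E_rec: "AE \<omega> in M. E t \<omega> = \<phi> * E (t - 1) \<omega> + Z t \<omega>"
  and E_sums: "AE \<omega> in M. (\<lambda>j. \<phi> ^ j * Z (t - int j) \<omega>) sums E t \<omega>"
proof -
  show "E t \<in> borel_measurable M" using AR1 unfolding stationary_AR1_def by blast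
  have "AE \<omega> in M. E t \<omega> - \<phi> * E (t - 1) \<omega> = Z t \<omega>" using AR1 unfolding stationary_AR1_def by blast
  then show "AE \<omega> in M. E t \<omega> = \<phi> * E (t - 1) \<omega> + Z t \<omega>" by eventually_elim simp
  show "AE \<omega> in M. (\<lambda>j. \<phi> ^ j * Z (t - int j) \<omega>) sums E t \<omega>"
    using AR1 unfolding stationary_AR1_def by blast
qed

section \<open>Moments of the stationary solution\<close>

lemma phi_square: "\<phi>\<^sup>2 < 1" "0 \<le> \<phi>\<^sup>2"
  using phi by (simp_all add: abs_square_less_1)

lemma v_nonneg: "0 \<le> v"
proof -
  have "v = expectation (\<lambda>\<omega>. (Z 0 \<omega>)\<^sup>2)" using Z_cov[of 0 0] by (simp add: power2_eq_square)
  then show ?thesis by simp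
qed

lemma Z_integrable: "integrable M (Z t)"
  by (rule square_integrable_imp_integrable[OF _ Z_square]) simp

lemma partial_sum_square:
  "integrable M (\<lambda>\<omega>. (\<Sum>j<k. \<phi> ^ j * Z (t - int j) \<omega>)\<^sup>2)" (is ?int)
  "expectation (\<lambda>\<omega>. (\<Sum>j<k. \<phi> ^ j * Z (t - int j) \<omega>)\<^sup>2) = (\<Sum>j<k. (\<phi>\<^sup>2) ^ j * v)" (is ?eq)
proof -
  have eq: "(\<Sum>j<k. \<phi> ^ j * Z (t - int j) \<omega>)\<^sup>2 =
      (\<Sum>i<k. \<Sum>j<k. \<phi> ^ i * \<phi> ^ j * (Z (t - int i) \<omega> * Z (t - int j) \<omega>))" for \<omega>
    by (simp add: power2_eq_square sum_product mult_ac)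
  have int: "integrable M (\<lambda>\<omega>. \<phi> ^ i * \<phi> ^ j * (Z (t - int i) \<omega> * Z (t - int j) \<omega>))" for i j
    by (intro integrable_mult_right integrable_mult_L2 Z_square) auto
  show ?int unfolding eq by (intro Bochner_Integration.integrable_sum int)
  have "expectation (\<lambda>\<omega>. (\<Sum>j<k. \<phi> ^ j * Z (t - int j) \<omega>)\<^sup>2) =
      (\<Sum>i<k. \<Sum>j<k. expectation (\<lambda>\<omega>. \<phi> ^ i * \<phi> ^ j * (Z (t - int i) \<omega> * Z (t - int j) \<omega>)))"
    unfolding eq by (subst Bochner_Integration.integral_sum; (intro Bochner_Integration.integrable_sum int)?)
      (intro sum.cong refl Bochner_Integration.integral_sum int)
  also have "\<dots> = (\<Sum>i<k. \<Sum>j<k. if i = j then (\<phi>\<^sup>2) ^ i * v else 0)"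
    by (intro sum.cong refl) (auto simp: Z_cov power2_eq_square power_mult_distrib)
  also have "\<dots> = (\<Sum>j<k. (\<phi>\<^sup>2) ^ j * v)" by simp
  finally show ?eq .
qed

text \<open>Orthogonality of the noise bounds the second moments of the partial sums by a geometric
  series, and Fatou's lemma keeps the bound. Equality follows later from a recursion.\<close>

lemma E_square: "integrable M (\<lambda>\<omega>. (E t \<omega>)\<^sup>2)"
  and E_square_le: "expectation (\<lambda>\<omega>. (E t \<omega>)\<^sup>2) \<le> v / (1 - \<phi>\<^sup>2)"
proof -
  have bound: "expectation (\<lambda>\<omega>. (\<Sum>j<k. \<phi> ^ j * Z (t - int j) \<omega>)\<^sup>2) \<le> v / (1 - \<phi>\<^sup>2)" for k
  proof -
    have "(\<Sum>j<k. (\<phi>\<^sup>2) ^ j) \<le> (\<Sum>j. (\<phi>\<^sup>2) ^ j)"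
      using phi_square by (intro sum_le_suminf summable_geometric) auto
    also have "\<dots> = 1 / (1 - \<phi>\<^sup>2)" using phi_square by (intro suminf_geometric) auto
    finally have "(\<Sum>j<k. (\<phi>\<^sup>2) ^ j) * v \<le> 1 / (1 - \<phi>\<^sup>2) * v"
      by (rule mult_right_mono[OF _ v_nonneg])
    then show ?thesis by (simp add: partial_sum_square sum_distrib_right)
  qed
  have lim: "AE \<omega> in M. (\<lambda>k. \<Sum>j<k. \<phi> ^ j * Z (t - int j) \<omega>) \<longlonglongrightarrow> E t \<omega>"
    using E_sums unfolding sums_def .
  show "integrable M (\<lambda>\<omega>. (E t \<omega>)\<^sup>2)" "expectation (\<lambda>\<omega>. (E t \<omega>)\<^sup>2) \<le> v / (1 - \<phi>\<^sup>2)"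
    by (rule Fatou_square_integrable[OF partial_sum_square(1) bound _ lim], simp)+
qed

lemma E_integrable: "integrable M (E t)"
  by (rule square_integrable_imp_integrable[OF _ E_square]) simp

lemma EE_integrable: "integrable M (\<lambda>\<omega>. E s \<omega> * E t \<omega>)"
  and EZ_integrable: "integrable M (\<lambda>\<omega>. E s \<omega> * Z t \<omega>)"
  and ZZ_integrable: "integrable M (\<lambda>\<omega>. Z s \<omega> * Z t \<omega>)"
  by (intro integrable_mult_L2 E_square Z_square; simp)+

lemma EZ_future:
  assumes "s < t"
  shows "expectation (\<lambda>\<omega>. E s \<omega> * Z t \<omega>) = 0"
proof (rule zero_by_contraction[OF phi, where f = "\<lambda>s. expectation (\<lambda>\<omega>. E s \<omega> * Z t \<omega>)"
      and C = "v / (1 - \<phi>\<^sup>2) + v"])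
  fix s
  have "\<bar>expectation (\<lambda>\<omega>. E s \<omega> * Z t \<omega>)\<bar> \<le> expectation (\<lambda>\<omega>. (E s \<omega>)\<^sup>2) + expectation (\<lambda>\<omega>. (Z t \<omega>)\<^sup>2)"
    by (intro abs_integral_mult_le E_square Z_square) auto
  then show "\<bar>expectation (\<lambda>\<omega>. E s \<omega> * Z t \<omega>)\<bar> \<le> v / (1 - \<phi>\<^sup>2) + v"
    using E_square_le[of s] Z_cov[of t t] by (simp add: power2_eq_square)
next
  fix u assume u: "u \<le> s"
  have "expectation (\<lambda>\<omega>. E u \<omega> * Z t \<omega>) =
      expectation (\<lambda>\<omega>. \<phi> * (E (u - 1) \<omega> * Z t \<omega>) + Z u \<omega> * Z t \<omega>)"
  proof (rule integral_cong_AE)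
    show "AE \<omega> in M. E u \<omega> * Z t \<omega> = \<phi> * (E (u - 1) \<omega> * Z t \<omega>) + Z u \<omega> * Z t \<omega>"
      using E_rec[of u] by eventually_elim (simp add: algebra_simps)
  qed measurable
  also have "\<dots> = \<phi> * expectation (\<lambda>\<omega>. E (u - 1) \<omega> * Z t \<omega>)"
    using u assms by (simp add: EZ_integrable ZZ_integrable Z_cov)
  finally show "expectation (\<lambda>\<omega>. E u \<omega> * Z t \<omega>) = \<phi> * expectation (\<lambda>\<omega>. E (u - 1) \<omega> * Z t \<omega>)" .
qed

lemma E_mean: "expectation (E t) = 0"
proof (rule zero_by_contraction[OF phi, where C = "v / (1 - \<phi>\<^sup>2) + 1"])
  fix t
  \<comment> \<open>Pairing with the constant 1 makes the product bound applicable; this is the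
    summand 1 in \<open>C\<close>.\<close>
  have "\<bar>expectation (\<lambda>\<omega>. E t \<omega> * 1)\<bar> \<le> expectation (\<lambda>\<omega>. (E t \<omega>)\<^sup>2) + expectation (\<lambda>\<omega>. 1\<^sup>2)"
    by (intro abs_integral_mult_le E_square) auto
  then show "\<bar>expectation (E t)\<bar> \<le> v / (1 - \<phi>\<^sup>2) + 1"
    using E_square_le[of t] by (simp add: prob_space)
next
  fix t
  have "expectation (E t) = expectation (\<lambda>\<omega>. \<phi> * E (t - 1) \<omega> + Z t \<omega>)"
    by (rule integral_cong_AE) (use E_rec in auto)
  then show "expectation (E t) = \<phi> * expectation (E (t - 1))"
    by (simp add: E_integrable Z_integrable Z_mean)
qed

lemma E_variance: "expectation (\<lambda>\<omega>. (E t \<omega>)\<^sup>2) = v / (1 - \<phi>\<^sup>2)"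
proof -
  let ?V = "\<lambda>t. expectation (\<lambda>\<omega>. (E t \<omega>)\<^sup>2)"
  have "?V t - v / (1 - \<phi>\<^sup>2) = 0"
  proof (rule zero_by_contraction[where c = "\<phi>\<^sup>2" and C = "v / (1 - \<phi>\<^sup>2)" and f = "\<lambda>t. ?V t - v / (1 - \<phi>\<^sup>2)"])
    show "\<bar>\<phi>\<^sup>2\<bar> < 1" using phi_square by simp
    \<comment> \<open>The second moment lies between 0 and its Fatou bound, so the deviation is
      bounded by that same value.\<close>
    show "\<bar>?V t - v / (1 - \<phi>\<^sup>2)\<bar> \<le> v / (1 - \<phi>\<^sup>2)" for t
      using E_square_le[of t] Bochner_Integration.integral_nonneg[of M "\<lambda>\<omega>. (E t \<omega>)\<^sup>2"] by (simp add: abs_le_iff)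
    fix t
    have "?V t = expectation (\<lambda>\<omega>. \<phi>\<^sup>2 * (E (t - 1) \<omega>)\<^sup>2 + 2 * \<phi> * (E (t - 1) \<omega> * Z t \<omega>) + (Z t \<omega>)\<^sup>2)"
    proof (rule integral_cong_AE)
      show "AE \<omega> in M. (E t \<omega>)\<^sup>2 = \<phi>\<^sup>2 * (E (t - 1) \<omega>)\<^sup>2 + 2 * \<phi> * (E (t - 1) \<omega> * Z t \<omega>) + (Z t \<omega>)\<^sup>2"
        using E_rec[of t] by eventually_elim (simp add: power2_eq_square algebra_simps)
    qed measurable
    also have "\<dots> = \<phi>\<^sup>2 * ?V (t - 1) + v"
      using EZ_future[of "t - 1" t] Z_cov[of t t, folded power2_eq_square]
      by (simp add: EZ_integrable E_square Z_square)
    finally have "?V t = \<phi>\<^sup>2 * ?V (t - 1) + v" .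
    moreover have "v = (1 - \<phi>\<^sup>2) * (v / (1 - \<phi>\<^sup>2))" using phi_square by simp
    ultimately show "?V t - v / (1 - \<phi>\<^sup>2) = \<phi>\<^sup>2 * (?V (t - 1) - v / (1 - \<phi>\<^sup>2))"
      by (simp only: algebra_simps)
  qed
  then show ?thesis by simp
qed

text \<open>The noise added at each further lag lies in the future of \<open>E s\<close> and is
  uncorrelated with it, so each lag contributes a factor \<phi>.\<close>

lemma E_autocovariance: "covariance M (E s) (E (s + int k)) = \<phi> ^ k * (v / (1 - \<phi>\<^sup>2))"
proof -
  have "expectation (\<lambda>\<omega>. E s \<omega> * E (s + int k) \<omega>) = \<phi> ^ k * (v / (1 - \<phi>\<^sup>2))"
  proof (induction k)
    case 0
    then show ?case using E_variance[of s] by (simp add: power2_eq_square)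
  next
    case (Suc k)
    have "expectation (\<lambda>\<omega>. E s \<omega> * E (s + int (Suc k)) \<omega>) =
        expectation (\<lambda>\<omega>. \<phi> * (E s \<omega> * E (s + int k) \<omega>) + E s \<omega> * Z (s + int (Suc k)) \<omega>)"
    proof (rule integral_cong_AE)
      show "AE \<omega> in M. E s \<omega> * E (s + int (Suc k)) \<omega> =
          \<phi> * (E s \<omega> * E (s + int k) \<omega>) + E s \<omega> * Z (s + int (Suc k)) \<omega>"
        using E_rec[of "s + int (Suc k)"] by eventually_elim (simp add: algebra_simps)
    qed measurable
    also have "\<dots> = \<phi> * expectation (\<lambda>\<omega>. E s \<omega> * E (s + int k) \<omega>)"
      using EZ_future[of s "s + int (Suc k)"] by (simp add: EE_integrable EZ_integrable)
    finally show ?case using Suc by simp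
  qed
  then show ?thesis by (simp add: covariance_def E_mean)
qed

lemma covariance_mat_AR1:
  "covariance_mat M q E = v / (1 - \<phi>\<^sup>2) \<cdot>\<^sub>m ar1_cov \<phi> q"
proof (rule eq_matI)
  have sym: "covariance M U V = covariance M V U" for U V :: "'a \<Rightarrow> real"
    by (simp add: covariance_def mult.commute)
  fix s t assume "s < dim_row (v / (1 - \<phi>\<^sup>2) \<cdot>\<^sub>m ar1_cov \<phi> q)"
    "t < dim_col (v / (1 - \<phi>\<^sup>2) \<cdot>\<^sub>m ar1_cov \<phi> q)"
  then show "covariance_mat M q E $$ (s, t) =
      (v / (1 - \<phi>\<^sup>2) \<cdot>\<^sub>m ar1_cov \<phi> q) $$ (s, t)"
    \<comment> \<open>The two instances cover the two triangles; symmetry of the covariance handles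
      the lower one.\<close>
    using E_autocovariance[of "int (Suc s)" "t - s"] E_autocovariance[of "int (Suc t)" "s - t"]
      sym[of "E (int (Suc s))" "E (int (Suc t))"]
    by (auto simp: covariance_mat_def ar1_cov_def)
qed (auto simp: covariance_mat_def ar1_cov_def)

end

text \<open>The passage from independent Gaussian noise to the second-order setting: the normal law
  gives mean and variance, independence the vanishing correlations.\<close>

lemma (in prob_space) white_noise_AR1_normal:
  assumes "\<bar>\<phi>\<bar> < 1" and \<sigma>: "0 < \<sigma>"
    and indep: "indep_vars (\<lambda>_. borel) (\<lambda>(i, t). Z i t) (I \<times> UNIV)" and i: "i \<in> I"
    and normal: "\<And>t. distributed M lborel (Z i t) (normal_density 0 \<sigma>)"
    and "stationary_AR1 M \<phi> (Z i) E"
  shows "white_noise_AR1 M \<phi> (\<sigma>\<^sup>2) (Z i) E"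
proof
  show [measurable]: "Z i t \<in> borel_measurable M" for t
    using distributed_measurable[OF normal] by simp
  show mean: "expectation (Z i t) = 0" for t
    using normal_distributed_expectation[OF \<sigma> normal] .
  have int: "integrable M (Z i t)" for t
    using distributed_integrable[OF normal[of t], of "\<lambda>x. x"] integrable_normal_moment_nz_1[OF \<sigma>, of 0] by simp
  show sq: "integrable M (\<lambda>\<omega>. (Z i t \<omega>)\<^sup>2)" for t
    using distributed_integrable[OF normal[of t], of "\<lambda>x. x\<^sup>2"] integrable_normal_moment[OF \<sigma>, of 0 2] by simp
  show "expectation (\<lambda>\<omega>. Z i s \<omega> * Z i t \<omega>) = (if s = t then \<sigma>\<^sup>2 else 0)" for s t
  proof (cases "s = t")
    case True
    then show ?thesis
      using normal_distributed_variance[OF \<sigma> normal[of t]] by (simp add: mean power2_eq_square)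
  next
    case False
    have "indep_vars (\<lambda>_. borel) (\<lambda>(i, t). Z i t) {(i, s), (i, t)}"
      using i by (intro indep_vars_subset[OF indep]) auto
    then have "expectation (\<lambda>\<omega>. \<Prod>k\<in>{(i, s), (i, t)}. (case k of (i, t) \<Rightarrow> Z i t) \<omega>) =
        (\<Prod>k\<in>{(i, s), (i, t)}. expectation (case k of (i, t) \<Rightarrow> Z i t))"
      by (intro indep_vars_lebesgue_integral) (auto simp: int)
    then show ?thesis using False by (simp add: mean)
  qed
qed fact+

section \<open>The irrepresentable condition\<close>

text \<open>\<open>SS\<close> is conditional on \<open>0 < p\<close> because identifying the
  covariance matrix needs an actual row of errors, and \<open>X'X\<close> guarantees one only when
  \<open>p\<close> is positive.\<close>

lemma irrepresentable_AR1:
  fixes X B S :: "real mat"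
  assumes phi: "\<bar>\<phi>\<bar> < 1" and v: "0 < v" and \<nu>: "0 < \<nu>"
    and X: "X \<in> carrier_mat n p" and B: "B \<in> carrier_mat p q" and S: "S \<in> carrier_mat q q"
    and SS: "0 < p \<Longrightarrow> mat_inv (v / (1 - \<phi>\<^sup>2) \<cdot>\<^sub>m ar1_cov \<phi> q) = S * transpose_mat S"
    and XX: "transpose_mat X * X = \<nu> \<cdot>\<^sub>m 1\<^sub>m p"
    and interior: "\<And>j. j \<in> support (vec_stack B) \<Longrightarrow> p < j \<and> j < p * q - p"
    and separated: "\<And>j. j \<in> {1..p * q} \<Longrightarrow>
           j - p \<notin> support (vec_stack B) \<or> j + p \<notin> support (vec_stack B)"
  shows "irrepresentable (kronecker (transpose_mat S) X) (vec_stack B) (1 - \<bar>\<phi>\<bar> / (1 + \<phi>\<^sup>2 - \<bar>\<phi>\<bar>))"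
proof -
  let ?b = "vec_stack B" and ?D = "kronecker (transpose_mat S) X"
  define J where "J = {a. a < dim_vec ?b \<and> ?b $ a \<noteq> 0}"
  have finJ: "finite J" by (simp add: J_def)
  have dim: "dim_vec ?b = p * q" using B by (simp add: vec_stack_def)
  have dimD: "dim_col ?D = dim_vec ?b" using X S by (simp add: dim kronecker_def)
  have J: "a \<in> J \<longleftrightarrow> Suc a \<in> support ?b" for a by (auto simp: J_def support_def)
  have den: "0 < 1 + \<phi>\<^sup>2 - \<bar>\<phi>\<bar>" using phi zero_le_power2[of \<phi>] by linarith
  have ratio: "0 \<le> \<bar>\<phi>\<bar> / (1 + \<phi>\<^sup>2 - \<bar>\<phi>\<bar>)" using den by simp
  show ?thesis
  proof (cases "J = {}")
    \<comment> \<open>All sums over \<open>J\<close> are empty, so any \<open>e < d\<close> with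
      \<open>e = 0\<close> will do.\<close>
    case True
    show ?thesis
      by (rule irrepresentable_dominant[where b = ?b and d = 1 and e = 0, folded J_def])
        (use True ratio dimD in simp_all)
  next
    case False
    then obtain a where "a \<in> J" by auto
    \<comment> \<open>An index strictly between \<open>p\<close> and \<open>p * q - p\<close> forces
      at least three blocks, enough for the formula for the precision matrix.\<close>
    then have "2 * p + 1 < p * q" using interior[of "Suc a"] by (auto simp: J)
    then have "p * 2 < p * q" by linarith
    then have p: "0 < p" and q: "2 < q" by auto
    define c where "c = \<nu> / v"
    have c: "0 < c" using \<nu> v by (simp add: c_def)
    have cov: "ar1_cov \<phi> q \<in> carrier_mat q q" and prec: "ar1_prec \<phi> q \<in> carrier_mat q q"
      by (auto simp: ar1_cov_def ar1_prec_def)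
    have "1 - \<phi>\<^sup>2 \<noteq> 0" using phi by (simp add: abs_square_eq_1)
    then have "(1 / v) \<cdot>\<^sub>m (v / (1 - \<phi>\<^sup>2) \<cdot>\<^sub>m (ar1_prec \<phi> q * ar1_cov \<phi> q)) = 1\<^sub>m q"
      using v q by (intro eq_matI) (auto simp: ar1_prec_mult_cov)
    then have "(1 / v) \<cdot>\<^sub>m ar1_prec \<phi> q * (v / (1 - \<phi>\<^sup>2) \<cdot>\<^sub>m ar1_cov \<phi> q) = 1\<^sub>m q"
      by (simp add: mult_smult_distrib[OF prec cov] mult_smult_assoc_mat[OF prec smult_carrier_mat[OF cov]])
    from mat_inv_unique(1)[OF _ _ this] have SS': "S * transpose_mat S = (1 / v) \<cdot>\<^sub>m ar1_prec \<phi> q"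
      using cov prec SS[OF p] by simp
    have G: "(transpose_mat ?D * ?D) $$ (a, k) =
        (if a mod p = k mod p then c * ar1_prec \<phi> q $$ (a div p, k div p) else 0)"
      if "a < p * q" "k < p * q" for a k
    proof -
      have "a div p < q" "k div p < q" using that by (auto simp: less_mult_imp_div_less mult.commute)
      then show ?thesis
        using that p S X prec gram_kronecker[of "transpose_mat S" q q X n p a k]
        by (simp add: SS' XX mult.commute c_def)
    qed
    show ?thesis
    proof (rule irrepresentable_dominant[where b = ?b and d = "c * (1 + \<phi>\<^sup>2)" and e = "c * \<bar>\<phi>\<bar>", folded J_def])
      fix a assume a: "a \<in> J"
      \<comment> \<open>After the shift to indices from 0, \<open>a\<close> lies neither in the
        first nor in the last block, so its diagonal entry is not a corner.\<close>
      then have a': "p \<le> a" "a + p < p * q" using interior[of "Suc a"] by (auto simp: J)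
      then have "a div p \<noteq> 0" "Suc (a div p) < q"
        using p less_mult_imp_div_less[of "a + p" q p] by (simp_all add: div_eq_0_iff mult.commute)
      then have "ar1_prec \<phi> q $$ (a div p, a div p) = 1 + \<phi>\<^sup>2"
        using p by (simp add: ar1_prec_def)
      then show "c * (1 + \<phi>\<^sup>2) \<le> \<bar>(transpose_mat ?D * ?D) $$ (a, a)\<bar>"
        using a' c by (simp add: G)
    next
      fix a assume "a < dim_vec ?b"
      then have a: "a < p * q" by (simp add: dim)
      \<comment> \<open>The only index besides \<open>a\<close> at which row \<open>a\<close> can
        meet \<open>J\<close>: by \<open>separated\<close>, the two neighbours are not both in the
        support. If \<open>a < p\<close>, truncation may yield 0, which is outside
        \<open>J\<close>.\<close>
      define t where "t = (if Suc a + p \<in> support ?b then a + p else a - p)"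
      have zero: "(transpose_mat ?D * ?D) $$ (a, k) = 0" if k: "k \<in> J" "k \<noteq> a" "k \<noteq> t" for k
      proof (rule ccontr)
        assume nz: "(transpose_mat ?D * ?D) $$ (a, k) \<noteq> 0"
        have kq: "k < p * q" using k by (simp add: J_def dim)
        have "a div p < q" "k div p < q" using a kq by (auto simp: less_mult_imp_div_less mult.commute)
        then have m: "a mod p = k mod p"
          and "a div p = k div p \<or> Suc (a div p) = k div p \<or> Suc (k div p) = a div p"
          using nz a kq by (auto simp: G ar1_prec_def split: if_splits)
        moreover have "k = a \<or> k = a + p \<or> a = k + p"
          if "a = x * p + r" "k = y * p + r" "x = y \<or> Suc x = y \<or> Suc y = x" for x y r
          using that by auto
        ultimately have "k = a \<or> k = a + p \<or> a = k + p"
          using div_mult_mod_eq by metis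
        then have "(k = a + p \<and> Suc a + p \<in> support ?b) \<or>
            (a = k + p \<and> Suc a - p \<in> support ?b)"
          using k by (auto simp: J Suc_diff_le)
        then show False
          using separated[of "Suc a"] a k by (auto simp: t_def)
      qed
      have bound: "\<bar>(transpose_mat ?D * ?D) $$ (a, k)\<bar> \<le> c * \<bar>\<phi>\<bar>" if k: "k \<in> J" "k \<noteq> a" for k
      proof -
        have kq: "k < p * q" using k by (simp add: J_def dim)
        have "a div p < q" "k div p < q" using a kq by (auto simp: less_mult_imp_div_less mult.commute)
        moreover have "a mod p = k mod p \<Longrightarrow> a div p \<noteq> k div p"
          \<comment> \<open>Equal remainder and equal block would force \<open>k = a\<close>; the
            entry is thus off the diagonal of the precision matrix.\<close>
          using k div_mult_mod_eq[of a p] div_mult_mod_eq[of k p] by metis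
        ultimately show ?thesis
          using c a kq by (auto simp: G ar1_prec_def abs_mult)
      qed
      have "(\<Sum>k\<in>J - {a}. \<bar>(transpose_mat ?D * ?D) $$ (a, k)\<bar>) =
          (\<Sum>k\<in>(J - {a}) \<inter> {t}. \<bar>(transpose_mat ?D * ?D) $$ (a, k)\<bar>)"
        using zero by (intro sum.mono_neutral_right) (auto simp: finJ)
      also have "\<dots> \<le> c * \<bar>\<phi>\<bar>"
        using bound[of t] c by (cases "t \<in> J \<and> t \<noteq> a") (auto simp: Int_insert_right)
      finally show "(\<Sum>k\<in>J - {a}. \<bar>(transpose_mat ?D * ?D) $$ (a, k)\<bar>) \<le> c * \<bar>\<phi>\<bar>" .
    next
      show "c * \<bar>\<phi>\<bar> < c * (1 + \<phi>\<^sup>2)" using den c by simp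
      \<comment> \<open>The scale \<open>c\<close> cancels from the ratio, so the constant depends
        on \<phi> alone.\<close>
      have "c * (1 + \<phi>\<^sup>2) - c * \<bar>\<phi>\<bar> = c * (1 + \<phi>\<^sup>2 - \<bar>\<phi>\<bar>)" by (simp add: algebra_simps)
      then show "c * \<bar>\<phi>\<bar> / (c * (1 + \<phi>\<^sup>2) - c * \<bar>\<phi>\<bar>) \<le> 1 - (1 - \<bar>\<phi>\<bar> / (1 + \<phi>\<^sup>2 - \<bar>\<phi>\<bar>))"
        using c by simp
      show "1 - \<bar>\<phi>\<bar> / (1 + \<phi>\<^sup>2 - \<bar>\<phi>\<bar>) \<le> 1" using ratio by simp
    qed (rule dimD)
  qed
qed

theorem proposition6:
  fixes p :: nat and \<phi> \<sigma> :: real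
    and N :: "nat set" and q :: "nat \<Rightarrow> nat" and \<nu> :: "nat \<Rightarrow> real"
    and X B \<Sigma> S :: "nat \<Rightarrow> real mat"
    and M :: "nat \<Rightarrow> 'a measure"
    and Z E :: "nat \<Rightarrow> nat \<Rightarrow> int \<Rightarrow> 'a \<Rightarrow> real"
    and Y :: "nat \<Rightarrow> 'a \<Rightarrow> real mat"
  assumes "\<bar>\<phi>\<bar> < 1" and "\<sigma> > 0"
    and "\<And>n. n \<in> N \<Longrightarrow> X n \<in> carrier_mat n p"
    and "\<And>n. n \<in> N \<Longrightarrow> B n \<in> carrier_mat p (q n)"
    and "\<And>n. n \<in> N \<Longrightarrow> prob_space (M n)"
    and "\<And>n \<omega>. n \<in> N \<Longrightarrow> \<omega> \<in> space (M n) \<Longrightarrow>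
           Y n \<omega> = X n * B n + sample_mat n (q n) (E n) \<omega>"
    and "\<And>n. n \<in> N \<Longrightarrow>
           prob_space.indep_vars (M n) (\<lambda>_. borel) (\<lambda>(i, t). Z n i t) ({1..n} \<times> UNIV)"
    and "\<And>n i t. n \<in> N \<Longrightarrow> i \<in> {1..n} \<Longrightarrow>
           distributed (M n) lborel (Z n i t) (normal_density 0 \<sigma>)"
    and "\<And>n i. n \<in> N \<Longrightarrow> i \<in> {1..n} \<Longrightarrow> stationary_AR1 (M n) \<phi> (Z n i) (E n i)"
    and "\<And>n. n \<in> N \<Longrightarrow>
           prob_space.indep_vars (M n) (\<lambda>_. Pi\<^sub>M UNIV (\<lambda>_. borel)) (\<lambda>i \<omega> t. E n i t \<omega>) {1..n}"
    and "\<And>n i. n \<in> N \<Longrightarrow> i \<in> {1..n} \<Longrightarrow> \<Sigma> n = covariance_mat (M n) (q n) (E n i)"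
    and "\<And>n. n \<in> N \<Longrightarrow> S n \<in> carrier_mat (q n) (q n)"
    and "\<And>n. n \<in> N \<Longrightarrow> mat_inv (\<Sigma> n) = S n * transpose_mat (S n)"
    and "\<And>n. n \<in> N \<Longrightarrow> \<nu> n > 0"
    and "\<And>n. n \<in> N \<Longrightarrow> transpose_mat (X n) * X n = \<nu> n \<cdot>\<^sub>m 1\<^sub>m p"
    and "\<And>n j. n \<in> N \<Longrightarrow> j \<in> support (vec_stack (B n)) \<Longrightarrow> p < j \<and> j < p * q n - p"
    and "\<And>n j. n \<in> N \<Longrightarrow> j \<in> {1..p * q n} \<Longrightarrow>
           j - p \<notin> support (vec_stack (B n)) \<or> j + p \<notin> support (vec_stack (B n))"
  shows "\<exists>\<eta>>0. \<forall>n\<in>N. irrepresentable (kronecker (transpose_mat (S n)) (X n)) (vec_stack (B n)) \<eta>"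
proof -
  \<comment> \<open>Expanding this square makes the witness for \<eta> positive; as it involves only
    \<phi>, it serves every \<open>n\<close>.\<close>
  have "0 < (1 - \<bar>\<phi>\<bar>)\<^sup>2" using assms(1) by (intro zero_less_power) simp
  then have lt: "\<bar>\<phi>\<bar> < 1 + \<phi>\<^sup>2 - \<bar>\<phi>\<bar>" by (simp add: power2_eq_square algebra_simps)
  then have "0 < 1 - \<bar>\<phi>\<bar> / (1 + \<phi>\<^sup>2 - \<bar>\<phi>\<bar>)" by (simp add: field_simps)
  moreover have "irrepresentable (kronecker (transpose_mat (S n)) (X n)) (vec_stack (B n))
      (1 - \<bar>\<phi>\<bar> / (1 + \<phi>\<^sup>2 - \<bar>\<phi>\<bar>))" if n: "n \<in> N" for n
  proof (rule irrepresentable_AR1)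
    show "0 < \<sigma>\<^sup>2" using assms(2) by simp
    assume p: "0 < p"
    \<comment> \<open>for \<open>n = 0\<close> there is no row, and \<open>\<Sigma> n\<close> is arbitrary\<close>
    have "n \<noteq> 0"
    proof
      assume "n = 0"
      then have "(transpose_mat (X n) * X n) $$ (0, 0) = 0"
        using assms(3)[OF n] p by (simp add: scalar_prod_def)
      then show False using assms(14)[OF n] p by (simp add: assms(15)[OF n])
    qed
    \<comment> \<open>All rows share the covariance matrix, so the first one suffices to identify
      it.\<close>
    then have 1: "1 \<in> {1..n}" by simp
    interpret prob_space "M n" by (rule assms(5)[OF n])
    interpret white_noise_AR1 "M n" \<phi> "\<sigma>\<^sup>2" "Z n 1" "E n 1"
      by (rule white_noise_AR1_normal[OF assms(1,2) assms(7)[OF n] 1 assms(8)[OF n 1] assms(9)[OF n 1]])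
    show "mat_inv (\<sigma>\<^sup>2 / (1 - \<phi>\<^sup>2) \<cdot>\<^sub>m ar1_cov \<phi> (q n)) = S n * transpose_mat (S n)"
      using assms(13)[OF n] unfolding assms(11)[OF n 1] covariance_mat_AR1 .
  qed (use n assms in auto)
  ultimately show ?thesis by blast
qed

end
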